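(* Let $\lambda$ be a nonzero real number. For all integers $n,k$ with $n\ge k\ge 1$, \[ {n \brack k}_{-\lambda}^{*} = \sum_{m=k}^n \binom{n}{m}\lambda^{m-k} S_1 (m,k ) \int_{[0,1]^k}\int_{[0,\infty)^k} \Big(\sum_{i=1}^k u_i x_i \Big)_{n-m,\lambda}e^{-(x_1+\cdots+x_k)}\,dx_1\cdots dx_k\, du_1 \cdots du_k. \]
   Context: The (signed) Stirling numbers of the first kind $S_1(n,k)$ are defined by $\frac{1}{k!}\log^k(1+t)=\sum_{n=k}^\infty S_1(n,k)\frac{t^n}{n!}$ for $k\ge0$. The degenerate falling factorial is $(x)_{0,\lambda}=1$, $(x)_{n,\lambda}=x(x-\lambda)(x-2\lambda)\cdots(x-(n-1)\lambda)$ for $n\ge1$. For nonzero real $\mu$, the unsigned new type degenerate Stirling numbers of the first kind ${n\brack k}_{\mu}^{*}$ are defined by $\frac{1}{k!}\log^k\!\left(\frac{1}{1+\frac{1}{\mu}\log(1-\mu t)}\right)=\sum_{n=k}^\infty {n\brack k}_{\mu}^{*}\frac{t^n}{n!}$ ($k\ge0$); ${n\brack k}_{-\lambda}^{*}$ is this with $\mu=-\lambda$, i.e. generated by $\frac{1}{k!}\log^k\!\left(\frac{1}{1-\frac{1}{\lambda}\log(1+\lambda t)}\right)$. *)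

theory Defs
  imports "HOL-Analysis.Analysis" "HOL-Computational_Algebra.Formal_Power_Series"
begin

text \<open>
  All generating functions are formal power series over the reals. In the library
  \<^term>\<open>fps_ln 1\<close> is the series of \<open>log (1 + t)\<close>, so for a series \<open>F\<close> with constant
  coefficient 1 the series of \<open>log F\<close> is the composition with \<open>F - 1\<close>; composition is
  only meaningful because \<open>F - 1\<close> has vanishing constant coefficient.
\<close>

definition fps_log :: "real fps \<Rightarrow> real fps" where
  "fps_log F = fps_ln 1 oo (F - 1)"

definition S1 :: "nat \<Rightarrow> nat \<Rightarrow> real" where
  "S1 n k = fact n * fps_nth (fps_const (1 / fact k) * fps_log (1 + fps_X) ^ k) n"

definition degenerate_ffact :: "real \<Rightarrow> nat \<Rightarrow> real \<Rightarrow> real" where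
  "degenerate_ffact x n lam = (\<Prod>j<n. x - real j * lam)"

definition new_degenerate_stirling1_gf :: "real \<Rightarrow> real fps" where
  "new_degenerate_stirling1_gf \<mu> =
     fps_log (1 / (1 + fps_const (1 / \<mu>) * fps_log (1 - fps_const \<mu> * fps_X)))"

definition new_degenerate_stirling1 :: "real \<Rightarrow> nat \<Rightarrow> nat \<Rightarrow> real" where
  "new_degenerate_stirling1 \<mu> n k =
     fact n * fps_nth (fps_const (1 / fact k) * new_degenerate_stirling1_gf \<mu> ^ k) n"

lemma fps_log_nth_0 [simp]: "fps_nth (fps_log F) 0 = 0"
  by (simp add: fps_log_def fps_ln_def)

lemma exp_fps_log:
  assumes "fps_nth F 0 = 1"
  shows "fps_exp 1 oo fps_log F = F"
proof -
  have inv: "fps_inv (fps_exp 1 - 1) = fps_ln (1::real)"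
    using fps_ln_fps_exp_inv[of "1::real"] by simp
  have "(fps_exp 1 - 1) oo fps_ln (1::real) = fps_X"
    using fps_inv_right[of "fps_exp 1 - 1 :: real fps"] by (simp add: inv)
  then have "((fps_exp 1 - 1) oo fps_ln (1::real)) oo (F - 1) = F - 1"
    using assms by (simp add: fps_X_fps_compose_startby0)
  then have "(fps_exp 1 - 1) oo fps_log F = F - 1"
    using fps_compose_assoc[of "F - 1" "fps_ln (1::real)" "fps_exp 1 - 1"] assms
    by (simp add: fps_log_def fps_ln_def)
  then show ?thesis
    by (simp add: fps_compose_sub_distrib)
qed

lemma S1_generating_function:
  "fps_const (1 / fact k) * fps_log (1 + fps_X) ^ k = Abs_fps (\<lambda>n. S1 n k / fact n)"
  by (simp add: fps_eq_iff S1_def)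

lemma S1_eq_0: "n < k \<Longrightarrow> S1 n k = 0"
  by (simp add: S1_def startsby_zero_power_prefix)

lemma new_degenerate_stirling1_generating_function:
  "fps_const (1 / fact k) * new_degenerate_stirling1_gf \<mu> ^ k =
     Abs_fps (\<lambda>n. new_degenerate_stirling1 \<mu> n k / fact n)"
  by (simp add: fps_eq_iff new_degenerate_stirling1_def)

lemma new_degenerate_stirling1_eq_0: "n < k \<Longrightarrow> new_degenerate_stirling1 \<mu> n k = 0"
  by (simp add: new_degenerate_stirling1_def new_degenerate_stirling1_gf_def
      startsby_zero_power_prefix)

lemma new_degenerate_stirling1_gf_exp:
  "fps_exp 1 oo new_degenerate_stirling1_gf \<mu> =
     1 / (1 + fps_const (1 / \<mu>) * fps_log (1 - fps_const \<mu> * fps_X))"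
  unfolding new_degenerate_stirling1_gf_def
  by (rule exp_fps_log) (simp add: fps_divide_unit)

end

theory Submission
  imports Defs "HOL-Probability.Sinc_Integral"
begin

text \<open>
  Put \<open>L(t) = log (1 + \<lambda> t) / \<lambda>\<close> and \<open>G(z) = \<Sum>j. z\<^sup>j / (j + 1)\<close>. Since
  \<open>- log (1 - z) = z G(z)\<close>, the generating function on the left is \<open>L\<^sup>k / k!\<close> times \<open>G(L)\<^sup>k\<close>; the
  first factor generates the numbers \<open>\<lambda>\<^sup>m\<^sup>-\<^sup>k S\<^sub>1(m, k)\<close>. As \<open>exp (y L)\<close> generates \<open>(y)\<^sub>n\<^sub>,\<^sub>\<lambda>\<close>, the second
  factor is identified with the generating function of the integrals by
  \<open>\<integral> \<integral> (u x)\<^sup>j / j! e\<^sup>-\<^sup>x dx du = 1 / (j + 1)\<close>, applied to each factor of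
  \<open>exp (\<Sum>i. u\<^sub>i x\<^sub>i z) = \<Prod>i. exp (u\<^sub>i x\<^sub>i z)\<close>, and the binomial convolution gives the formula.
\<close>

section \<open>Logarithms as formal power series\<close>

definition fps_degenerate_log :: "real \<Rightarrow> real fps" where
  "fps_degenerate_log lam = fps_const (1 / lam) * fps_log (1 + fps_const lam * fps_X)"

definition fps_neg_log_quotient :: "real fps" where
  "fps_neg_log_quotient = Abs_fps (\<lambda>j. 1 / (real j + 1))"

lemma fps_degenerate_log_nth_0 [simp]: "fps_nth (fps_degenerate_log lam) 0 = 0"
  by (simp add: fps_degenerate_log_def)

lemma fps_log_one_plus_linear:
  "fps_log (1 + fps_const lam * fps_X) = fps_ln 1 oo (fps_const lam * fps_X)"
  by (simp add: fps_log_def)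

text \<open>Chain rule: the derivative \<open>1 / (1 + X)\<close> of the logarithm series, composed
  with \<open>F - 1\<close>, is \<open>inverse F\<close>.\<close>

lemma fps_deriv_log:
  assumes "fps_nth F 0 = 1"
  shows "fps_deriv (fps_log F) = inverse F * fps_deriv F"
proof -
  have "inverse (1 + fps_X) oo (F - 1) = inverse (F :: real fps)"
    using assms by (subst fps_inverse_compose) (simp_all add: fps_compose_add_distrib fps_X_fps_compose_startby0)
  then show ?thesis
    using assms by (simp add: fps_log_def fps_compose_deriv fps_ln_deriv fps_divide_unit)
qed

text \<open>The derivative of \<open>L\<close> is \<open>1 / (1 + lam t)\<close>; clearing the
  denominator prepares a linear differential equation with polynomial coefficients.\<close>

lemma fps_deriv_degenerate_log:
  assumes "lam \<noteq> 0"
  shows "(1 + fps_const lam * fps_X) * fps_deriv (fps_degenerate_log lam) = 1"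
proof -
  let ?F = "1 + fps_const lam * fps_X"
  have inv: "?F * inverse ?F = 1"
    by (rule inverse_mult_eq_1') simp
  have "fps_deriv (fps_degenerate_log lam) = fps_const (1 / lam) * (inverse ?F * fps_const lam)"
    by (simp add: fps_degenerate_log_def fps_deriv_log)
  also have "\<dots> = fps_const (1 / lam * lam) * inverse ?F"
    by (simp only: fps_const_mult[symmetric] mult_ac)
  also have "\<dots> = inverse ?F"
    using assms by simp
  finally show ?thesis
    using inv by simp
qed

text \<open>Both sides have constant coefficient 0 and the geometric series as derivative.\<close>

lemma fps_log_geometric: "fps_log (inverse (1 - fps_X)) = fps_X * fps_neg_log_quotient"
proof -
  let ?G = "1 - fps_X :: real fps"
  have geom: "inverse ?G = Abs_fps (\<lambda>_. 1)"
    using fps_inverse_gp'[where ?'a = real] fps_inverse_idempotent[of "Abs_fps (\<lambda>_. 1::real)"]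
    by simp
  have "fps_deriv (fps_log (inverse ?G)) = ?G * (inverse ?G)\<^sup>2"
    by (subst fps_deriv_log) (simp_all add: fps_inverse_deriv)
  also have "\<dots> = inverse ?G"
    using inverse_mult_eq_1'[of ?G] by (simp add: power2_eq_square mult.assoc[symmetric])
  also have "\<dots> = fps_deriv (fps_X * fps_neg_log_quotient)"
    \<comment> \<open>Coefficientwise, the factor \<open>n + 1\<close> from differentiation cancels
      the denominator of \<open>G\<close>; the product rule would hide this.\<close>
    by (simp add: geom fps_eq_iff fps_neg_log_quotient_def del: fps_deriv_mult)
  finally show ?thesis
    unfolding fps_deriv_eq_iff by simp
qed

text \<open>At parameter \<open>- lam\<close> the inner series is \<open>1 - L\<close>, so the
  generating function is the logarithm of the geometric series with \<open>L\<close> substituted for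
  \<open>X\<close>.\<close>

lemma new_degenerate_stirling1_gf_eq:
  "new_degenerate_stirling1_gf (- lam) =
     fps_degenerate_log lam * (fps_neg_log_quotient oo fps_degenerate_log lam)"
proof -
  let ?L = "fps_degenerate_log lam" and ?F = "inverse (1 - fps_X) :: real fps"
  have "?F oo ?L = inverse (1 - ?L)"
    by (simp add: fps_inverse_compose fps_compose_sub_distrib fps_X_fps_compose_startby0)
  then have "fps_log (inverse (1 - ?L)) = fps_ln 1 oo ((?F - 1) oo ?L)"
    by (simp add: fps_log_def fps_compose_sub_distrib)
  also have "\<dots> = fps_log ?F oo ?L"
    by (subst fps_compose_assoc) (simp_all add: fps_log_def)
  also have "\<dots> = ?L * (fps_neg_log_quotient oo ?L)"
    by (simp add: fps_log_geometric fps_compose_mult_distrib fps_X_fps_compose_startby0)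
  finally have log: "fps_log (inverse (1 - ?L)) = \<dots>" .
  have "1 + fps_const (1 / - lam) * fps_log (1 - fps_const (- lam) * fps_X) = 1 - ?L"
    by (simp add: fps_degenerate_log_def flip: fps_const_neg)
  then show ?thesis
    unfolding new_degenerate_stirling1_gf_def using log by (simp add: fps_divide_unit)
qed

text \<open>Rescaling: substituting \<open>lam X\<close> multiplies the \<open>m\<close>-th
  coefficient by \<open>lam ^ m\<close>, and the prefactor of \<open>L\<close> contributes
  \<open>1 / lam ^ k\<close>. The case split is there because \<open>m - k\<close> is truncated
  subtraction.\<close>

lemma degenerate_log_power_nth:
  assumes "lam \<noteq> 0"
  shows "fps_nth (fps_const (1 / fact k) * fps_degenerate_log lam ^ k) m =
    (if k \<le> m then lam ^ (m - k) * S1 m k / fact m else 0)"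
proof -
  have "fps_degenerate_log lam ^ k = fps_const (1 / lam ^ k) * (fps_ln 1 ^ k oo (fps_const lam * fps_X))"
    by (simp add: fps_degenerate_log_def fps_log_one_plus_linear power_mult_distrib
        fps_compose_power fps_const_power power_one_over)
  then have "fps_nth (fps_const (1 / fact k) * fps_degenerate_log lam ^ k) m =
      1 / fact k * (1 / lam ^ k * (lam ^ m * fps_nth (fps_ln 1 ^ k) m))"
    by (simp add: fps_compose_linear)
  also have "\<dots> = lam ^ m / lam ^ k * S1 m k / fact m"
    by (simp add: S1_def fps_log_def)
  also have "\<dots> = (if k \<le> m then lam ^ (m - k) * S1 m k / fact m else 0)"
    using assms by (simp add: S1_eq_0 power_diff)
  finally show ?thesis .
qed

section \<open>Degenerate falling factorials\<close>

lemma degenerate_ffact_generating_function: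
  assumes "lam \<noteq> 0"
  shows "fps_exp y oo fps_degenerate_log lam = Abs_fps (\<lambda>n. degenerate_ffact y n lam / fact n)"
proof -
  let ?E = "fps_exp y oo fps_degenerate_log lam"
  have "(1 + fps_const lam * fps_X) * fps_deriv ?E =
      fps_const y * ?E * ((1 + fps_const lam * fps_X) * fps_deriv (fps_degenerate_log lam))"
    by (simp add: fps_compose_deriv fps_compose_mult_distrib mult_ac)
  then have ode: "(1 + fps_const lam * fps_X) * fps_deriv ?E = fps_const y * ?E"
    by (simp add: fps_deriv_degenerate_log[OF assms])
  \<comment> \<open>Comparing coefficients in the differential equation yields the recurrence
    satisfied by \<open>degenerate_ffact y n lam / fact n\<close>.\<close>
  have rec: "(real n + 1) * fps_nth ?E (Suc n) = (y - real n * lam) * fps_nth ?E n" for n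
  proof -
    have "fps_nth ((1 + fps_const lam * fps_X) * fps_deriv ?E) n =
        (real n + 1) * fps_nth ?E (Suc n) + lam * (real n * fps_nth ?E n)"
      by (cases n) (simp_all add: distrib_right mult.assoc add.commute)
    then show ?thesis
      unfolding ode by (simp add: algebra_simps)
  qed
  have "fps_nth ?E n = degenerate_ffact y n lam / fact n" for n
  proof (induction n)
    case 0
    then show ?case by (simp add: degenerate_ffact_def)
  next
    case (Suc n)
    have "fps_nth ?E (Suc n) = (y - real n * lam) * fps_nth ?E n / (real n + 1)"
      using rec[of n] by (simp add: field_simps)
    then show ?case
      by (simp add: Suc.IH degenerate_ffact_def field_simps)
  qed
  then show ?thesis
    by (simp add: fps_eq_iff)
qed

text \<open>A finite expansion in \<open>y ^ j / fact j\<close> with coefficients independent of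
  \<open>y\<close>, so that it can be integrated termwise.\<close>

lemma degenerate_ffact_eq_sum:
  assumes "lam \<noteq> 0"
  shows "degenerate_ffact y n lam =
    (\<Sum>j=0..n. fact n * fps_nth (fps_degenerate_log lam ^ j) n * (y ^ j / fact j))"
proof -
  have "degenerate_ffact y n lam = fact n * fps_nth (fps_exp y oo fps_degenerate_log lam) n"
    by (simp add: degenerate_ffact_generating_function[OF assms])
  then show ?thesis
    by (simp add: fps_compose_nth sum_distrib_left mult_ac)
qed

section \<open>Integrals over the orthant and the cube\<close>

lemma fps_exp_sum:
  fixes y :: "'i \<Rightarrow> real"
  assumes "finite I"
  shows "fps_exp (\<Sum>i\<in>I. y i) = (\<Prod>i\<in>I. fps_exp (y i))"
  using assms by induction (simp_all add: fps_exp_add_mult)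

text \<open>The multinomial theorem, with exponent vectors encoded as multisets: compare
  coefficients in the factorisation of the exponential of a sum.\<close>

lemma power_sum_divide_fact:
  fixes y :: "'i \<Rightarrow> real"
  assumes "finite I"
  shows "(\<Sum>i\<in>I. y i) ^ j / fact j =
    (\<Sum>X\<in>multisets_of_size I j. \<Prod>i\<in>I. y i ^ count X i / fact (count X i))"
proof -
  have "(\<Sum>i\<in>I. y i) ^ j / fact j = fps_nth (\<Prod>i\<in>I. fps_exp (y i)) j"
    by (simp flip: fps_exp_sum[OF assms])
  then show ?thesis
    by (simp add: fps_prod_nth'[OF assms])
qed

lemma has_bochner_integral_PiM_prod:
  fixes f :: "'i \<Rightarrow> real \<Rightarrow> real"
  assumes "finite I" "\<And>i. i \<in> I \<Longrightarrow> has_bochner_integral lborel (f i) (c i)"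
  shows "has_bochner_integral (\<Pi>\<^sub>M i\<in>I. lborel) (\<lambda>x. \<Prod>i\<in>I. f i (x i)) (\<Prod>i\<in>I. c i)"
proof -
  interpret product_sigma_finite "\<lambda>_::'i. lborel :: real measure" ..
  show ?thesis
    using assms product_integrable_prod[of I f] product_integral_prod[of I f]
    by (auto simp: has_bochner_integral_iff intro!: prod.cong)
qed

text \<open>Points of the product space are extensional, so membership in the box is decided
  coordinatewise.\<close>

lemma indicator_PiE_eq_prod:
  assumes "finite I" "x \<in> space (\<Pi>\<^sub>M i\<in>I. lborel)"
  shows "(indicator (\<Pi>\<^sub>E i\<in>I. A) x :: real) = (\<Prod>i\<in>I. indicator A (x i))"
  using assms by (auto simp: indicator_def space_PiM PiE_def Pi_def prod.If_cases prod_eq_1_iff)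

lemma has_bochner_integral_unit_interval_power:
  "has_bochner_integral lborel (\<lambda>u::real. u ^ j * indicator {0..1} u) (1 / (real j + 1))"
proof -
  have deriv: "((\<lambda>u. u ^ Suc j / (real j + 1)) has_real_derivative u ^ j) (at u)" for u
    using DERIV_cdivide[OF DERIV_pow[of "Suc j" u UNIV], of "real j + 1"] by (simp add: add.commute)
  have "has_bochner_integral lborel (\<lambda>u::real. u ^ j * indicator {0..1} u)
      (1 ^ Suc j / (real j + 1) - 0 ^ Suc j / (real j + 1))"
    by (rule has_bochner_integral_FTC_Icc_real)
      (auto intro!: deriv continuous_intros simp del: power_Suc)
  then show ?thesis by simp
qed

text \<open>The Gamma integral of \<open>t ^ m * exp (- t)\<close> cancels \<open>fact m\<close> in
  each coordinate, leaving the complete homogeneous symmetric polynomial of degree \<open>j\<close>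
  in the \<open>u i\<close>.\<close>

lemma has_bochner_integral_power_sum_exp:
  fixes u :: "'i \<Rightarrow> real"
  assumes "finite I"
  shows "has_bochner_integral (\<Pi>\<^sub>M i\<in>I. lborel)
    (\<lambda>x. indicator (\<Pi>\<^sub>E i\<in>I. {0..}) x *
      ((\<Sum>i\<in>I. u i * x i) ^ j / fact j * exp (- (\<Sum>i\<in>I. x i))))
    (\<Sum>X\<in>multisets_of_size I j. \<Prod>i\<in>I. u i ^ count X i)"
proof -
  have one: "has_bochner_integral lborel
      (\<lambda>t::real. (c * t) ^ m / fact m * (exp (- t) * indicator {0..} t)) (c ^ m)" for c m
    using has_bochner_integral_mult_right[OF has_bochner_integral_I0i_power_exp_m'[of m],
        of "c ^ m / fact m"]
    by (simp add: power_mult_distrib mult_ac)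
  have "has_bochner_integral (\<Pi>\<^sub>M i\<in>I. lborel)
     (\<lambda>x. \<Sum>X\<in>multisets_of_size I j. \<Prod>i\<in>I.
        (u i * x i) ^ count X i / fact (count X i) * (exp (- x i) * indicator {0..} (x i)))
     (\<Sum>X\<in>multisets_of_size I j. \<Prod>i\<in>I. u i ^ count X i)"
    by (intro has_bochner_integral_sum has_bochner_integral_PiM_prod assms one)
  then show ?thesis
    by (rule has_bochner_integral_cong[THEN iffD1, rotated -1])
      (simp_all add: power_sum_divide_fact[OF assms] indicator_PiE_eq_prod[OF assms] exp_sum[OF assms]
        prod.distrib prod_dividef sum_distrib_left sum_distrib_right mult_ac flip: sum_negf)
qed

text \<open>Each monomial integrates to a product of coefficients of \<open>G\<close>; summing over
  multisets of size \<open>j\<close> is the Cauchy product of \<open>card I\<close> copies of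
  \<open>G\<close>.\<close>

lemma has_bochner_integral_cube_monomials:
  assumes "finite I"
  shows "has_bochner_integral (\<Pi>\<^sub>M i\<in>I. lborel)
    (\<lambda>u. indicator (\<Pi>\<^sub>E i\<in>I. {0..1}) u * (\<Sum>X\<in>multisets_of_size I j. \<Prod>i\<in>I. u i ^ count X i))
    (fps_nth (fps_neg_log_quotient ^ card I) j)"
proof -
  have "has_bochner_integral (\<Pi>\<^sub>M i\<in>I. lborel)
     (\<lambda>u. \<Sum>X\<in>multisets_of_size I j. \<Prod>i\<in>I. u i ^ count X i * indicator {0..1} (u i))
     (\<Sum>X\<in>multisets_of_size I j. \<Prod>i\<in>I. 1 / (real (count X i) + 1))"
    by (intro has_bochner_integral_sum has_bochner_integral_PiM_prod assms
        has_bochner_integral_unit_interval_power)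
  moreover have "fps_nth (fps_neg_log_quotient ^ card I) j =
      (\<Sum>X\<in>multisets_of_size I j. \<Prod>i\<in>I. 1 / (real (count X i) + 1))"
    using fps_prod_nth'[OF assms, of "\<lambda>_. fps_neg_log_quotient" j]
    by (simp add: fps_neg_log_quotient_def)
  ultimately have "has_bochner_integral (\<Pi>\<^sub>M i\<in>I. lborel)
     (\<lambda>u. \<Sum>X\<in>multisets_of_size I j. \<Prod>i\<in>I. u i ^ count X i * indicator {0..1} (u i))
     (fps_nth (fps_neg_log_quotient ^ card I) j)"
    by simp
  then show ?thesis
    by (rule has_bochner_integral_cong[THEN iffD1, rotated -1])
      (simp_all add: indicator_PiE_eq_prod[OF assms] prod.distrib sum_distrib_left mult_ac)
qed

lemma degenerate_ffact_exp_integral: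
  assumes "lam \<noteq> 0" "finite I"
  shows "(LINT u : (\<Pi>\<^sub>E i\<in>I. {0..1}) | (\<Pi>\<^sub>M i\<in>I. lborel).
      (LINT x : (\<Pi>\<^sub>E i\<in>I. {0..}) | (\<Pi>\<^sub>M i\<in>I. lborel).
        degenerate_ffact (\<Sum>i\<in>I. u i * x i) n lam * exp (- (\<Sum>i\<in>I. x i)))) =
    fact n * fps_nth ((fps_neg_log_quotient oo fps_degenerate_log lam) ^ card I) n"
proof -
  \<comment> \<open>These are the coefficients of \<open>y ^ j / fact j\<close> in the degenerate
    falling factorial; they depend on neither \<open>u\<close> nor \<open>x\<close> and pass through
    both integrals.\<close>
  define c where "c j = fact n * fps_nth (fps_degenerate_log lam ^ j) n" for j
  let ?P = "\<lambda>j (u :: 'a \<Rightarrow> real). \<Sum>X\<in>multisets_of_size I j. \<Prod>i\<in>I. u i ^ count X i"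
  have "(LINT x : (\<Pi>\<^sub>E i\<in>I. {0..}) | (\<Pi>\<^sub>M i\<in>I. lborel).
      degenerate_ffact (\<Sum>i\<in>I. u i * x i) n lam * exp (- (\<Sum>i\<in>I. x i))) = (\<Sum>j=0..n. c j * ?P j u)"
    for u
  proof -
    have "has_bochner_integral (\<Pi>\<^sub>M i\<in>I. lborel)
      (\<lambda>x. \<Sum>j=0..n. c j * (indicator (\<Pi>\<^sub>E i\<in>I. {0..}) x *
        ((\<Sum>i\<in>I. u i * x i) ^ j / fact j * exp (- (\<Sum>i\<in>I. x i))))) (\<Sum>j=0..n. c j * ?P j u)"
      by (intro has_bochner_integral_sum has_bochner_integral_mult_right
          has_bochner_integral_power_sum_exp assms)
    then show ?thesis
      unfolding set_lebesgue_integral_def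
      by (intro has_bochner_integral_integral_eq)
        (simp add: degenerate_ffact_eq_sum[OF assms(1)] c_def sum_distrib_left sum_distrib_right mult_ac)
  qed
  moreover have "(LINT u : (\<Pi>\<^sub>E i\<in>I. {0..1}) | (\<Pi>\<^sub>M i\<in>I. lborel). (\<Sum>j=0..n. c j * ?P j u)) =
      (\<Sum>j=0..n. c j * fps_nth (fps_neg_log_quotient ^ card I) j)"
  proof -
    have "has_bochner_integral (\<Pi>\<^sub>M i\<in>I. lborel)
      (\<lambda>u. \<Sum>j=0..n. c j * (indicator (\<Pi>\<^sub>E i\<in>I. {0..1}) u * ?P j u))
      (\<Sum>j=0..n. c j * fps_nth (fps_neg_log_quotient ^ card I) j)"
      by (intro has_bochner_integral_sum has_bochner_integral_mult_right
          has_bochner_integral_cube_monomials assms)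
    then show ?thesis
      unfolding set_lebesgue_integral_def
      by (intro has_bochner_integral_integral_eq) (simp add: sum_distrib_left mult_ac)
  qed
  \<comment> \<open>The sum is the coefficient formula for \<open>G ^ card I\<close> composed with
    \<open>L\<close>.\<close>
  moreover have "(\<Sum>j=0..n. c j * fps_nth (fps_neg_log_quotient ^ card I) j) =
      fact n * fps_nth ((fps_neg_log_quotient oo fps_degenerate_log lam) ^ card I) n"
    by (simp add: c_def fps_compose_power fps_compose_nth sum_distrib_left mult_ac)
  ultimately show ?thesis
    by simp
qed

section \<open>Assembly by binomial convolution\<close>

theorem theorem2p3:
  fixes lam :: real and n k :: nat
  assumes "lam \<noteq> 0" and "k \<ge> 1" and "n \<ge> k"
  shows "new_degenerate_stirling1 (-lam) n k =
    (\<Sum>m=k..n. real (n choose m) * lam ^ (m - k) * S1 m k *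
      (LINT u : (\<Pi>\<^sub>E i\<in>{1..k}. {0..1}) | (\<Pi>\<^sub>M i\<in>{1..k}. lborel).
        (LINT x : (\<Pi>\<^sub>E i\<in>{1..k}. {0..}) | (\<Pi>\<^sub>M i\<in>{1..k}. lborel).
          degenerate_ffact (\<Sum>i=1..k. u i * x i) (n - m) lam * exp (- (\<Sum>i=1..k. x i)))))"
proof -
  let ?L = "fps_degenerate_log lam"
  let ?A = "fps_const (1 / fact k) * ?L ^ k" and ?B = "(fps_neg_log_quotient oo ?L) ^ k"
  have "new_degenerate_stirling1 (- lam) n k = fact n * fps_nth (?A * ?B) n"
    by (simp only: new_degenerate_stirling1_def new_degenerate_stirling1_gf_eq power_mult_distrib mult.assoc)
  also have "\<dots> = (\<Sum>m=0..n. fact n * (fps_nth ?A m * fps_nth ?B (n - m)))"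
    by (simp only: fps_mult_nth sum_distrib_left)
  also have "\<dots> = (\<Sum>m=k..n. fact n * (fps_nth ?A m * fps_nth ?B (n - m)))"
    \<comment> \<open>Terms with \<open>m < k\<close> vanish, since \<open>L ^ k\<close> has no
      coefficients below \<open>k\<close>.\<close>
    by (rule sum.mono_neutral_right) (auto simp only: degenerate_log_power_nth[OF assms(1)] split: if_splits, auto)
  also have "\<dots> = (\<Sum>m=k..n. real (n choose m) * lam ^ (m - k) * S1 m k *
      (fact (n - m) * fps_nth ?B (n - m)))"
    \<comment> \<open>Here \<open>fact n / fact m\<close> is rewritten as
      \<open>(n choose m) * fact (n - m)\<close>.\<close>
    by (rule sum.cong) (simp_all only: degenerate_log_power_nth[OF assms(1)],
        simp add: binomial_fact field_simps)
  finally show ?thesis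
    by (simp add: degenerate_ffact_exp_integral[OF assms(1)])
qed

end
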